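(* For every integer $m\ge 2$, the graph $P_m$ is well-covered.
   Context: For $m\ge2$, $P_m$ is the graph with vertex set $X\cup Y\cup Z$, $X=\{x_1,\ldots,x_{2m}\}$, $Y=\{y_1,y_2\}$, $Z=\{z_1,z_2,z_3\}$, whose edges are exactly: (i) the induced subgraph on $X$ is the complete $m$-partite graph $K_{2,\ldots,2}$ whose complement is the matching $\{x_{2i-1},x_{2i}\}$, $1\le i\le m$ (so $x_a,x_b$ are adjacent iff $\{a,b\}\ne\{2i-1,2i\}$ for all $i$); (ii) $y_1$ is adjacent to $z_1$ and to each $x_{2i-1}$, $1\le i\le m$; (iii) $y_2$ is adjacent to $z_2$ and to each $x_{2i}$, $1\le i\le m$; (iv) $Z$ induces a triangle $K_3$. A graph is well-covered if all its maximal independent sets have the same cardinality. *)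

theory Defs
  imports "Graph_Theory.Pair_Digraph"
begin

text \<open>
  A finite simple graph is a pair digraph satisfying \<^locale>\<open>pair_graph\<close> (finite, loop-free,
  symmetric arc set): an edge \<open>uv\<close> is represented by the two arcs \<open>(u, v)\<close> and \<open>(v, u)\<close>.
\<close>

definition independent_set :: "'a pair_pre_digraph \<Rightarrow> 'a set \<Rightarrow> bool" where
  "independent_set G S \<longleftrightarrow> S \<subseteq> pverts G \<and> (\<forall>u\<in>S. \<forall>v\<in>S. (u, v) \<notin> parcs G)"

definition maximal_independent_set :: "'a pair_pre_digraph \<Rightarrow> 'a set \<Rightarrow> bool" where
  "maximal_independent_set G S \<longleftrightarrow>
     independent_set G S \<and> (\<forall>T. independent_set G T \<and> S \<subseteq> T \<longrightarrow> T = S)"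

definition well_covered :: "'a pair_pre_digraph \<Rightarrow> bool" where
  "well_covered G \<longleftrightarrow>
     (\<forall>S T. maximal_independent_set G S \<and> maximal_independent_set G T \<longrightarrow> card S = card T)"

datatype P_vertex = vx nat | vy nat | vz nat

definition P_vertices :: "nat \<Rightarrow> P_vertex set" where
  "P_vertices m = vx ` {1..2*m} \<union> vy ` {1, 2} \<union> vz ` {1, 2, 3}"

text \<open>One or both orientations of every edge; \<open>P_graph\<close> below takes the symmetric closure.\<close>

definition P_edges :: "nat \<Rightarrow> (P_vertex \<times> P_vertex) set" where
  "P_edges m =
     {(vx a, vx b) | a b. a \<in> {1..2*m} \<and> b \<in> {1..2*m} \<and> a \<noteq> b \<and>
                        (\<forall>i\<in>{1..m}. {a, b} \<noteq> {2*i - 1, 2*i})}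
   \<union> {(vy 1, vz 1)} \<union> {(vy 1, vx (2*i - 1)) | i. i \<in> {1..m}}
   \<union> {(vy 2, vz 2)} \<union> {(vy 2, vx (2*i)) | i. i \<in> {1..m}}
   \<union> {(vz a, vz b) | a b. a \<in> {1, 2, 3} \<and> b \<in> {1, 2, 3} \<and> a \<noteq> b}"

definition P_graph :: "nat \<Rightarrow> P_vertex pair_pre_digraph" where
  "P_graph m = \<lparr> pverts = P_vertices m, parcs = P_edges m \<union> (P_edges m)\<inverse> \<rparr>"

lemma pair_graph_P_graph: "pair_graph (P_graph m)"
proof -
  have sub: "P_edges m \<subseteq> P_vertices m \<times> P_vertices m"
    unfolding P_edges_def P_vertices_def by fastforce
  have loopfree: "u \<noteq> v" if "(u, v) \<in> P_edges m" for u v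
    using that unfolding P_edges_def by blast
  have fin: "finite (P_vertices m)"
    by (simp add: P_vertices_def)
  have fin_edges: "finite (P_edges m)"
    using sub fin by (meson finite_SigmaI finite_subset)
  show ?thesis
  proof unfold_locales
    show "symmetric (with_proj (P_graph m))"
      by (auto simp: symmetric_def P_graph_def intro: symI)
  qed (use sub fin fin_edges loopfree in \<open>fastforce simp: P_graph_def\<close>)+
qed

end

theory Submission
  imports Defs
begin

text \<open>
  Every maximal independent set \<open>S\<close> has exactly three elements.  It meets the triangle \<open>Z\<close> in
  exactly one vertex, since \<open>z\<^sub>3\<close> has no neighbours outside \<open>Z\<close>.  It meets \<open>X\<close> only inside some pair
  \<open>{x\<^sub>2\<^sub>i\<^sub>-\<^sub>1, x\<^sub>2\<^sub>i}\<close>, and all neighbours of \<open>x\<^sub>2\<^sub>i\<^sub>-\<^sub>1\<close> other than \<open>y\<^sub>1\<close> lie in other pairs, so \<open>S\<close> contains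
  exactly one of \<open>x\<^sub>2\<^sub>i\<^sub>-\<^sub>1, y\<^sub>1\<close>; likewise exactly one of \<open>x\<^sub>2\<^sub>i, y\<^sub>2\<close>.
\<close>

text \<open>Otherwise \<open>insert v S\<close> would be a strictly larger independent set; symmetry
  excludes the arcs into \<open>v\<close>, and there is no loop at \<open>v\<close>.\<close>

lemma maximal_independent_set_dominating:
  assumes "maximal_independent_set G S" "v \<in> pverts G" "v \<notin> S"
    and "(v, v) \<notin> parcs G" "sym (parcs G)"
  shows "\<exists>u\<in>S. (v, u) \<in> parcs G"
proof (rule ccontr)
  assume "\<not> ?thesis"
  then have "independent_set G (insert v S)"
    using assms unfolding maximal_independent_set_def independent_set_def
    by (auto dest: symD)
  then show False
    using assms unfolding maximal_independent_set_def by blast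
qed

text \<open>The map \<open>a \<mapsto> (a + 1) div 2\<close> sends both \<open>2*i - 1\<close> and
  \<open>2*i\<close> to \<open>i\<close>, so it computes the index of the pair containing
  \<open>a\<close>. Adjacency inside X becomes inequality of indices.\<close>

lemma matched_pair_iff:
  fixes a b m :: nat
  assumes "a \<in> {1..2*m}" "a \<noteq> b"
  shows "(\<exists>i\<in>{1..m}. {a, b} = {2*i - 1, 2*i}) \<longleftrightarrow> (a + 1) div 2 = (b + 1) div 2"
proof
  assume "\<exists>i\<in>{1..m}. {a, b} = {2*i - 1, 2*i}"
  then show "(a + 1) div 2 = (b + 1) div 2"
    by (auto simp: doubleton_eq_iff)
next
  assume eq: "(a + 1) div 2 = (b + 1) div 2"
  define i where "i = (a + 1) div 2"
  have "i \<in> {1..m}" using assms unfolding i_def by auto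
  moreover have "a = 2*i - 1 \<and> b = 2*i \<or> a = 2*i \<and> b = 2*i - 1"
  proof -
    have "2*i \<le> a + 1" "a + 1 < 2*i + 2" "2*i \<le> b + 1" "b + 1 < 2*i + 2"
      using eq unfolding i_def by linarith+
    then show ?thesis using assms(2) by linarith
  qed
  ultimately show "\<exists>i\<in>{1..m}. {a, b} = {2*i - 1, 2*i}" by blast
qed

lemma parcs_P_graph_vx_vx:
  "(vx a, vx b) \<in> parcs (P_graph m) \<longleftrightarrow>
     a \<in> {1..2*m} \<and> b \<in> {1..2*m} \<and> (a + 1) div 2 \<noteq> (b + 1) div 2"
proof -
  have "(vx a, vx b) \<in> parcs (P_graph m) \<longleftrightarrow> a \<in> {1..2*m} \<and> b \<in> {1..2*m} \<and> a \<noteq> b \<and>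
      \<not> (\<exists>i\<in>{1..m}. {a, b} = {2*i - 1, 2*i})"
    unfolding P_graph_def P_edges_def by (auto simp: insert_commute)
  then show ?thesis using matched_pair_iff[of a m b] by auto
qed

lemma parcs_P_graph_vx_vy:
  assumes "i \<in> {1..m}"
  shows "(vx (2*i - 1), vy j) \<in> parcs (P_graph m) \<longleftrightarrow> j = 1"
    and "(vx (2*i), vy j) \<in> parcs (P_graph m) \<longleftrightarrow> j = 2"
proof -
  \<comment> \<open>Subtraction on naturals truncates, so \<open>2*i - 1\<close> is odd only because
    \<open>i \<ge> 1\<close>.\<close>
  have "2*i - 1 \<noteq> 2*k" for k using assms by (simp; presburger)
  then show "(vx (2*i - 1), vy j) \<in> parcs (P_graph m) \<longleftrightarrow> j = 1"
    using assms unfolding P_graph_def P_edges_def by auto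
  have "2*i \<noteq> 2*k - 1" if "k \<ge> 1" for k using that by presburger
  then show "(vx (2*i), vy j) \<in> parcs (P_graph m) \<longleftrightarrow> j = 2"
    using assms unfolding P_graph_def P_edges_def by auto
qed

lemma parcs_P_graph_vx_vz: "(vx a, vz c) \<notin> parcs (P_graph m)"
  unfolding P_graph_def P_edges_def by auto

lemma parcs_P_graph_vz_vz:
  "(vz a, vz b) \<in> parcs (P_graph m) \<longleftrightarrow> a \<in> {1, 2, 3} \<and> b \<in> {1, 2, 3} \<and> a \<noteq> b"
  unfolding P_graph_def P_edges_def by auto

lemma parcs_P_graph_vz3: "(vz 3, u) \<in> parcs (P_graph m) \<Longrightarrow> u \<in> {vz 1, vz 2}"
  unfolding P_graph_def P_edges_def by auto

lemma card_maximal_independent_set_P_graph: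
  assumes m: "m \<ge> 1" and S: "maximal_independent_set (P_graph m) S"
  shows "card S = 3"
proof -
  let ?A = "parcs (P_graph m)"
  have indep: "(u, v) \<notin> ?A" if "u \<in> S" "v \<in> S" for u v
    using S that unfolding maximal_independent_set_def independent_set_def by blast
  have sub: "S \<subseteq> P_vertices m"
    using S unfolding maximal_independent_set_def independent_set_def P_graph_def by auto
  have "sym ?A" by (auto simp: P_graph_def intro: symI)
  moreover have "(v, v) \<notin> ?A" for v
    unfolding P_graph_def P_edges_def by auto
  ultimately have dom: "\<exists>u\<in>S. (v, u) \<in> ?A" if "v \<in> P_vertices m" "v \<notin> S" for v
    using maximal_independent_set_dominating[OF S] that by (simp add: P_graph_def)

  have vxD: "a \<in> {1..2*m}" if "vx a \<in> S" for a
    using that sub unfolding P_vertices_def by auto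
  have vyD: "j \<in> {1, 2}" if "vy j \<in> S" for j
    using that sub unfolding P_vertices_def by auto
  have vzD: "c \<in> {1, 2, 3}" if "vz c \<in> S" for c
    using that sub unfolding P_vertices_def by auto

  have "\<exists>c. vz c \<in> S"
    using dom[of "vz 3"] parcs_P_graph_vz3 unfolding P_vertices_def by blast
  then obtain c where c: "vz c \<in> S" ..
  have c_unique: "d = c" if "vz d \<in> S" for d
    using that c indep[OF that c] vzD parcs_P_graph_vz_vz by blast

  \<comment> \<open>Vertices from different pairs are adjacent, so all members of \<open>S\<close>
    in X share one index.\<close>
  obtain i where i: "i \<in> {1..m}" and pair: "\<And>a. vx a \<in> S \<Longrightarrow> (a + 1) div 2 = i"
  proof (cases "\<exists>a. vx a \<in> S")
    case True
    then obtain a where a: "vx a \<in> S" ..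
    show ?thesis
    proof (rule that)
      show "(a + 1) div 2 \<in> {1..m}" using vxD[OF a] by auto
      show "(b + 1) div 2 = (a + 1) div 2" if "vx b \<in> S" for b
        using indep[OF that a] vxD a that parcs_P_graph_vx_vx by blast
    qed
  next
    case False
    \<comment> \<open>If \<open>S\<close> misses X, any index works; 1 is available since
      \<open>m \<ge> 1\<close>.\<close>
    then show ?thesis using that[of 1] m by auto
  qed
  have pair': "a = 2*i - 1 \<or> a = 2*i" if "vx a \<in> S" for a
    using pair[OF that] by presburger
  \<comment> \<open>Stated for a general \<open>y\<close> neighbour \<open>j\<close>, so that it
    serves both vertices of pair \<open>i\<close>.\<close>
  have one: "vx a \<in> S \<longleftrightarrow> vy j \<notin> S"
    if a: "a \<in> {1..2*m}" "(a + 1) div 2 = i" and adj: "\<And>k. (vx a, vy k) \<in> ?A \<longleftrightarrow> k = j" for a j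
  proof
    assume "vx a \<in> S"
    then show "vy j \<notin> S" using indep adj by blast
  next
    assume y: "vy j \<notin> S"
    show "vx a \<in> S"
    proof (rule ccontr)
      assume "vx a \<notin> S"
      moreover have "vx a \<in> P_vertices m" using a unfolding P_vertices_def by auto
      \<comment> \<open>No such \<open>u\<close> exists: members of \<open>S\<close> in X have index
        \<open>i\<close>, like \<open>a\<close>, the only \<open>vy\<close> neighbour is outside
        \<open>S\<close>, and no \<open>vz\<close> is adjacent to \<open>vx a\<close>.\<close>
      ultimately obtain u where u: "u \<in> S" "(vx a, u) \<in> ?A" using dom by blast
      show False
      proof (cases u)
        case (vx b)
        then show False using u a pair[of b] by (simp add: parcs_P_graph_vx_vx)
      next
        case (vy k)
        then show False using u adj y by simp
      next
        case (vz d)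
        then show False using u parcs_P_graph_vx_vz by simp
      qed
    qed
  qed
  have odd: "vx (2*i - 1) \<in> S \<longleftrightarrow> vy 1 \<notin> S"
    using i by (intro one[OF _ _ parcs_P_graph_vx_vy(1)[OF i]]) auto
  have even: "vx (2*i) \<in> S \<longleftrightarrow> vy 2 \<notin> S"
    using i by (intro one[OF _ _ parcs_P_graph_vx_vy(2)[OF i]]) auto

  have "S = {if vy 1 \<in> S then vy 1 else vx (2*i - 1), if vy 2 \<in> S then vy 2 else vx (2*i), vz c}"
    (is "S = ?T")
  proof (rule set_eqI)
    fix u show "u \<in> S \<longleftrightarrow> u \<in> ?T"
    proof (cases u)
      case (vx a)
      then show ?thesis using odd even pair' by auto
    next
      case (vy j)
      then show ?thesis using vyD by auto
    next
      case (vz d)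
      then show ?thesis using c c_unique[of d] by auto
    qed
  qed
  then have "card S = card ?T" by (rule arg_cong)
  also have "card ?T = 3"
  proof -
    \<comment> \<open>The only entries of \<open>?T\<close> that could coincide are the two
      \<open>vx\<close> ones, when neither \<open>vy\<close> lies in \<open>S\<close>.\<close>
    have "2*i - 1 \<noteq> 2*i" using i by auto
    then show ?thesis by simp
  qed
  finally show ?thesis .
qed

theorem theorem6p6:
  fixes m :: nat
  assumes "m \<ge> 2"
  shows "well_covered (P_graph m)"
  using assms card_maximal_independent_set_P_graph[of m] unfolding well_covered_def by simp

end
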